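(* Let $s > -1/d$ and let $r = 1 + s$. Let $X$ and $Y$ be (possibly dependent) random vectors in $\mathbb{R}^d$ with the same density $f$ being $s$-concave. Then $$N_r(X+Y) \leq 4 N_r(X).$$
   Context: For a random vector $X$ in $\mathbb{R}^d$ with density $f$ with respect to Lebesgue measure and $r \in (0,1)\cup(1,\infty)$, the $r$-R\'enyi entropy is $h_r(X) = \frac{1}{1-r}\log \int_{\mathbb{R}^d} f(x)^r\,dx$; for $r=1$, $h_1(X) = -\int_{\mathbb{R}^d} f\log f\,dx$; for $r=0$, $h_0(X)=\log|\mathrm{supp}(f)|$; for $r=\infty$, $h_\infty(X) = -\log\|f\|_\infty$. The $r$-R\'enyi entropy power is $N_r(X) = e^{2h_r(X)/d}$. For $s\in[-\infty,\infty]$, a function $f:\mathbb{R}^d\to[0,\infty)$ is called $s$-concave if $f((1-\lambda)x+\lambda y) \geq ((1-\lambda)f(x)^s+\lambda f(y)^s)^{1/s}$ for all $x,y\in\mathbb{R}^d$ with $f(x)f(y)>0$ and all $\lambda\in(0,1)$; the right-hand side is understood as $\min\{f(x),f(y)\}$ for $s=-\infty$, $f(x)^{1-\lambda}f(y)^\lambda$ for $s=0$ (log-concavity), and $\max\{f(x),f(y)\}$ for $s=\infty$. *)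

theory Defs
  imports "HOL-Probability.Probability"
begin

definition ext_ln :: "ennreal \<Rightarrow> ereal" where
  "ext_ln x = (if x = 0 then -\<infinity> else if x = \<infinity> then \<infinity> else ereal (ln (enn2real x)))"

definition ext_exp :: "ereal \<Rightarrow> ennreal" where
  "ext_exp x = (if x = -\<infinity> then 0 else if x = \<infinity> then \<infinity> else ennreal (exp (real_of_ereal x)))"

definition has_density :: "'a measure \<Rightarrow> ('a \<Rightarrow> real ^ 'n) \<Rightarrow> (real ^ 'n \<Rightarrow> real) \<Rightarrow> bool" where
  "has_density M X f \<longleftrightarrow> (\<forall>x. 0 \<le> f x) \<and> distributed M lborel X (\<lambda>x. ennreal (f x))"

text \<open>
  Differential entropy as an extended real: \<open>- \<integral> f ln f\<close> is split into its positive and negative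
  parts, since the integral need not be finite. (If both parts are infinite the integral is
  undefined; the value is then \<open>\<infinity> - \<infinity> = \<infinity>\<close>.)
\<close>

definition shannon_entropy_density :: "(real ^ 'n \<Rightarrow> real) \<Rightarrow> ereal" where
  "shannon_entropy_density f =
     enn2ereal (\<integral>\<^sup>+ x. ennreal (- (f x * ln (f x))) \<partial>lborel) -
     enn2ereal (\<integral>\<^sup>+ x. ennreal (f x * ln (f x)) \<partial>lborel)"

text \<open>
  Only orders \<open>r\<close> in \<open>[0, \<infinity>]\<close> are meaningful. The norm of \<open>f\<close> for \<open>r = \<infinity>\<close> is the essential
  supremum. The set where \<open>f\<close> is positive is used as the support for \<open>r = 0\<close>, which makes the value
  invariant under changing \<open>f\<close> on a null set.
\<close>

definition renyi_entropy_density :: "ereal \<Rightarrow> (real ^ 'n \<Rightarrow> real) \<Rightarrow> ereal" where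
  "renyi_entropy_density r f =
     (if r = 0 then ext_ln (emeasure lborel {x. f x > 0})
      else if r = 1 then shannon_entropy_density f
      else if r = \<infinity> then - ext_ln (esssup lborel (\<lambda>x. ennreal (f x)))
      else ereal (1 / (1 - real_of_ereal r)) *
             ext_ln (\<integral>\<^sup>+ x. ennreal (f x powr real_of_ereal r) \<partial>lborel))"

text \<open>
  The entropy of a random vector is that of any of its densities (the choice is immaterial, see
  \<open>renyi_entropy_eq\<close> below). A random vector whose law is not absolutely continuous has
  entropy \<open>-\<infinity>\<close>, hence entropy power \<open>0\<close>.
\<close>

definition renyi_entropy :: "'a measure \<Rightarrow> ereal \<Rightarrow> ('a \<Rightarrow> real ^ 'n) \<Rightarrow> ereal" where
  "renyi_entropy M r X =
     (if \<exists>f. has_density M X f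
      then renyi_entropy_density r (SOME f. has_density M X f) else -\<infinity>)"

definition renyi_entropy_power :: "'a measure \<Rightarrow> ereal \<Rightarrow> ('a \<Rightarrow> real ^ 'n) \<Rightarrow> ennreal" where
  "renyi_entropy_power M r X = ext_exp (2 * renyi_entropy M r X / ereal (real CARD('n)))"

definition s_mean :: "ereal \<Rightarrow> real \<Rightarrow> real \<Rightarrow> real \<Rightarrow> real" where
  "s_mean s t a b =
     (if s = -\<infinity> then min a b
      else if s = \<infinity> then max a b
      else if s = 0 then a powr (1 - t) * b powr t
      else ((1 - t) * a powr real_of_ereal s + t * b powr real_of_ereal s)
             powr (1 / real_of_ereal s))"

definition s_concave :: "ereal \<Rightarrow> (real ^ 'n \<Rightarrow> real) \<Rightarrow> bool" where
  "s_concave s f \<longleftrightarrow>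
     (\<forall>x. 0 \<le> f x) \<and>
     (\<forall>x y t. f x * f y > 0 \<and> 0 < t \<and> t < 1 \<longrightarrow>
        f ((1 - t) *\<^sub>R x + t *\<^sub>R y) \<ge> s_mean s t (f x) (f y))"

lemma has_density_measurable: "has_density M X f \<Longrightarrow> f \<in> borel_measurable lborel"
  unfolding has_density_def using distributed_real_measurable[of lborel f M X] by auto

lemma renyi_entropy_density_cong_AE:
  fixes f g :: "real ^ 'n \<Rightarrow> real"
  assumes fm: "f \<in> borel_measurable lborel" and gm: "g \<in> borel_measurable lborel"
    and ae: "AE x in lborel. f x = g x"
  shows "renyi_entropy_density r f = renyi_entropy_density r g"
proof -
  have "emeasure lborel {x. f x > 0} = emeasure lborel {x. g x > 0}"
    using ae fm gm by (intro emeasure_eq_AE) (auto elim!: eventually_mono)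
  moreover have "esssup lborel (\<lambda>x. ennreal (f x)) = esssup lborel (\<lambda>x. ennreal (g x))"
    using ae by (intro esssup_AE_cong measurable_compose[OF fm] measurable_compose[OF gm])
      (auto elim!: eventually_mono)
  moreover have "(\<integral>\<^sup>+ x. F (f x) \<partial>lborel) = (\<integral>\<^sup>+ x. F (g x) \<partial>lborel)" for F :: "real \<Rightarrow> ennreal"
    using ae by (intro nn_integral_cong_AE) (auto elim!: eventually_mono)
  note this[of "\<lambda>t. ennreal (- (t * ln t))"] this[of "\<lambda>t. ennreal (t * ln t)"]
    this[of "\<lambda>t. ennreal (t powr real_of_ereal r)"]
  ultimately show ?thesis
    unfolding renyi_entropy_density_def shannon_entropy_density_def by simp
qed

lemma renyi_entropy_eq:
  fixes X :: "'a \<Rightarrow> real ^ 'n"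
  assumes "prob_space M" "has_density M X f"
  shows "renyi_entropy M r X = renyi_entropy_density r f"
proof -
  interpret prob_space M by fact
  define g where "g = (SOME f. has_density M X f)"
  have g: "has_density M X g"
    unfolding g_def using assms(2) by (rule someI[of "has_density M X"])
  have "AE x in lborel. ennreal (g x) = ennreal (f x)"
    using g assms(2) unfolding has_density_def by (intro distributed_unique[of lborel X]) auto
  then have "AE x in lborel. g x = f x"
    using g assms(2) by (auto simp: has_density_def elim!: eventually_mono)
  then have "renyi_entropy_density r g = renyi_entropy_density r f"
    using g assms(2) by (intro renyi_entropy_density_cong_AE has_density_measurable)
  then show ?thesis
    using assms(2) unfolding renyi_entropy_def g_def by auto
qed

end

theory Submission
  imports Defs
begin

text \<open>
  Let \<open>h\<close> be a density of \<open>X + Y\<close>; when there is none the entropy power of the sum is \<open>0\<close>. Put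
  \<open>d = CARD('n)\<close> and \<open>q w = f (w / 2) / 2 ^ d\<close>, which is a density of \<open>2 X\<close>. The entropy power bound
  says that the entropy of order \<open>1 + s\<close> of \<open>h\<close> is at most that of \<open>q\<close>, which is the entropy of \<open>f\<close>
  plus \<open>d * ln 2\<close>. Two ingredients give this.

  First, the dependence between \<open>X\<close> and \<open>Y\<close> disappears when a convex function is evaluated at the
  midpoint: if \<open>\<phi>\<close> is midpoint convex on the support of \<open>f\<close>, then the expectation of
  \<open>\<phi> ((X + Y) / 2)\<close> is at most the average of those of \<open>\<phi> X\<close> and \<open>\<phi> Y\<close>, and these are
  equal because both marginals are \<open>f\<close> (\<open>midpoint_convex_le\<close>, and \<open>midpoint_concave_ge\<close> for the
  reverse). Concavity of order \<open>s\<close> supplies \<open>\<phi>\<close>: the power \<open>f powr s\<close> is convex for \<open>s < 0\<close> and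
  concave for \<open>s > 0\<close>, the function \<open>- ln f\<close> is convex for \<open>s = 0\<close>, and the indicator of a superlevel
  set is concave for \<open>s = \<infinity>\<close>.

  Second, the resulting cross term \<open>\<integral> h * q powr s\<close> (or \<open>- \<integral> h * ln q\<close>) is compared with the entropies
  of \<open>h\<close> and \<open>q\<close> through a pointwise Young (or Gibbs) inequality. Because \<open>q\<close> is already on the scale at
  which this inequality is sharp, integrating it gives exactly the conclusion that Hoelder's inequality
  would give.

  For \<open>0 \<le> s < \<infinity>\<close> the argument cancels integrals that could a priori be infinite. Replacing \<open>f\<close> by
  \<open>min f n\<close> in \<open>\<phi>\<close> keeps the concavity and makes those integrals finite; Fatou's lemma then removes the
  truncation.
\<close>

section \<open>Extended real arithmetic\<close>

lemma ext_ln_mono: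
  assumes "x \<le> y"
  shows "ext_ln x \<le> ext_ln y"
proof (cases "x = 0 \<or> y = \<infinity>")
  case True
  then show ?thesis by (auto simp: ext_ln_def)
next
  case False
  then have "x \<noteq> \<infinity>" "y \<noteq> 0" "y < top" "x > 0"
    using assms by (auto simp: less_top zero_less_iff_neq_zero)
  moreover have "0 < enn2real x" "enn2real x \<le> enn2real y"
    using calculation assms False by (auto simp: enn2real_positive_iff less_top intro: enn2real_mono)
  ultimately show ?thesis using False by (simp add: ext_ln_def)
qed

lemma ext_ln_cmult:
  assumes "c > 0"
  shows "ext_ln (ennreal c * x) = ereal (ln c) + ext_ln x"
proof -
  consider "x = 0" | "x = \<infinity>" | "x \<noteq> 0" "x \<noteq> \<infinity>" by blast
  then show ?thesis
  proof cases
    case 3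
    then have "0 < enn2real x"
      by (simp add: enn2real_positive_iff less_top zero_less_iff_neq_zero)
    then show ?thesis
      using assms 3 by (auto simp: ext_ln_def enn2real_mult ln_mult ennreal_mult_eq_top_iff)
  qed (use assms in \<open>auto simp: ext_ln_def ennreal_mult_top\<close>)
qed

lemma ext_exp_mono: "x \<le> y \<Longrightarrow> ext_exp x \<le> ext_exp y"
  by (cases x; cases y) (auto simp: ext_exp_def)

lemma ext_exp_add_ereal: "ext_exp (x + ereal c) = ennreal (exp c) * ext_exp x"
  by (cases x) (auto simp: ext_exp_def exp_add ennreal_mult' ennreal_mult_top mult.commute)

text \<open>
  An additive loss of \<open>d * ln 2\<close> in the entropy is a factor \<open>2\<^sup>2 = 4\<close> in the entropy power.
\<close>

lemma ext_exp_entropy_power_mono: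
  assumes "a \<le> b + ereal (ln (2 ^ d))" "d > 0"
  shows "ext_exp (2 * a / ereal (real d)) \<le> 4 * ext_exp (2 * b / ereal (real d))"
proof -
  have "2 * a / ereal (real d) \<le> 2 * b / ereal (real d) + ereal (2 * ln 2)"
    using assms
    by (cases a; cases b) (auto simp: field_simps ln_realpow)
  then have "ext_exp (2 * a / ereal (real d)) \<le> ext_exp (2 * b / ereal (real d) + ereal (2 * ln 2))"
    by (rule ext_exp_mono)
  also have "\<dots> = ennreal (exp (ln 4)) * ext_exp (2 * b / ereal (real d))"
    unfolding ext_exp_add_ereal using ln_realpow[of 2 2] by simp
  finally show ?thesis by simp
qed

lemma ennreal_2_mult_le_iff: "(2::ennreal) * a \<le> 2 * b \<longleftrightarrow> a \<le> b"
  using ennreal_mult_le_mult_iff[of 2 a b] by simp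

text \<open>
  Shannon entropy is a difference of two integrals, either of which may be infinite. Bounds on it
  are proved in the cross-added form, where no subtraction occurs. With \<open>a'\<close> infinite the conclusion could
  fail, since \<open>\<infinity> - \<infinity> = \<infinity>\<close>.
\<close>

lemma enn2ereal_diff_le:
  fixes a a' b b' :: ennreal
  assumes "a \<noteq> \<infinity>" "a' \<noteq> \<infinity>" "b + a' \<le> a + ennreal c + b'" "0 \<le> c"
  shows "enn2ereal a' - enn2ereal b' \<le> enn2ereal a - enn2ereal b + ereal c"
proof -
  obtain x where x: "a = ennreal x" "0 \<le> x" using assms(1) by (cases a) auto
  obtain x' where x': "a' = ennreal x'" "0 \<le> x'" using assms(2) by (cases a') auto
  show ?thesis
  proof (cases "b' = \<infinity>")
    case False
    then obtain y' where y': "b' = ennreal y'" "0 \<le> y'" by (cases b') auto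
    then have "b \<noteq> \<infinity>" using assms(3) x by (auto simp: top_unique)
    then obtain y where y: "b = ennreal y" "0 \<le> y" by (cases b) auto
    have "y + x' \<le> x + c + y'"
      using assms(3,4) x x' y y' by (simp flip: ennreal_plus)
    then show ?thesis using x x' y y' by (simp add: enn2ereal_ennreal)
  qed (simp add: x x' enn2ereal_ennreal)
qed

section \<open>Integrals under dilation and truncation\<close>

lemma nn_integral_dilate:
  fixes F :: "real ^ 'n \<Rightarrow> ennreal"
  assumes [measurable]: "F \<in> borel_measurable borel"
  shows "(\<integral>\<^sup>+ w. F ((1/2) *\<^sub>R w) \<partial>lborel) = ennreal (2 ^ CARD('n)) * (\<integral>\<^sup>+ x. F x \<partial>lborel)"
proof -
  have "(\<integral>\<^sup>+ w. F ((1/2) *\<^sub>R w) \<partial>lborel) =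
      (\<integral>\<^sup>+ w. F ((1/2) *\<^sub>R w) \<partial>density (distr lborel borel (\<lambda>x::real^'n. 0 + 2 *\<^sub>R x)) (\<lambda>_. \<bar>2\<bar>^DIM(real^'n)))"
    by (subst lborel_affine[of 2 0]) (simp_all flip: ennreal_power)
  also have "\<dots> = ennreal (2 ^ CARD('n)) * (\<integral>\<^sup>+ x. F x \<partial>lborel)"
    by (subst nn_integral_density; simp add: nn_integral_distr nn_integral_cmult flip: ennreal_power)
  finally show ?thesis .
qed

text \<open>
  The Jacobian \<open>2 ^ d\<close> of the dilation and the normalising factor \<open>2 ^ d\<close> of the dilated density
  combine to a net factor \<open>2 powr (- d * s)\<close>.
\<close>

lemma dilated_powr_integral:
  fixes F :: "real ^ 'n \<Rightarrow> real"
  assumes [measurable]: "F \<in> borel_measurable borel" and "\<And>x. F x \<ge> 0"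
  shows "(\<integral>\<^sup>+ w. ennreal ((F ((1/2) *\<^sub>R w) / 2 ^ CARD('n)) powr (1 + s)) \<partial>lborel)
    = ennreal ((2 ^ CARD('n)) powr (- s)) * (\<integral>\<^sup>+ x. ennreal (F x powr (1 + s)) \<partial>lborel)"
proof -
  let ?K = "2 ^ CARD('n) :: real"
  have "(F x / ?K) powr (1 + s) = ?K powr (- (1 + s)) * F x powr (1 + s)" for x
    using assms(2)[of x] powr_minus_divide[of ?K "1 + s"] by (simp add: powr_divide)
  then have "(\<integral>\<^sup>+ w. ennreal ((F ((1/2) *\<^sub>R w) / ?K) powr (1 + s)) \<partial>lborel)
      = ennreal ?K * (ennreal (?K powr (- (1 + s))) * (\<integral>\<^sup>+ x. ennreal (F x powr (1 + s)) \<partial>lborel))"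
    by (subst nn_integral_dilate[where F="\<lambda>x. ennreal ((F x / 2 ^ CARD('n)) powr (1 + s))"])
      (simp_all add: ennreal_mult' nn_integral_cmult)
  also have "\<dots> = ennreal (?K * ?K powr (- (1 + s))) * (\<integral>\<^sup>+ x. ennreal (F x powr (1 + s)) \<partial>lborel)"
    by (simp add: ennreal_mult' mult.assoc)
  also have "?K * ?K powr (- (1 + s)) = ?K powr (- s)"
    using powr_add[of ?K 1 "- (1 + s)"] by simp
  finally show ?thesis .
qed

text \<open>
  At each point the truncations are eventually constant, so Fatou's lemma suffices and \<open>F\<close> need not
  be monotone, which matters for \<open>t * ln t\<close>.
\<close>

lemma nn_integral_le_if_truncations_le:
  fixes f :: "'b \<Rightarrow> real" and F :: "real \<Rightarrow> ennreal"
  assumes [measurable]: "f \<in> borel_measurable N" "F \<in> borel_measurable borel"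
    and bound: "\<And>n::nat. n \<ge> 1 \<Longrightarrow> (\<integral>\<^sup>+ x. F (min (f x) (real n)) \<partial>N) \<le> K"
  shows "(\<integral>\<^sup>+ x. F (f x) \<partial>N) \<le> K"
proof -
  have "liminf (\<lambda>n. F (min (f x) (real n))) = F (f x)" for x
  proof -
    obtain m :: nat where "f x \<le> real m" using real_arch_simple by blast
    then have "\<forall>\<^sub>F n in sequentially. F (min (f x) (real n)) = F (f x)"
      by (intro eventually_sequentiallyI[of m]) (simp add: min_def)
    then show ?thesis
      by (intro lim_imp_Liminf tendsto_eventually) auto
  qed
  then have "(\<integral>\<^sup>+ x. F (f x) \<partial>N) \<le> liminf (\<lambda>n. \<integral>\<^sup>+ x. F (min (f x) (real n)) \<partial>N)"
    using nn_integral_liminf[of "\<lambda>n x. F (min (f x) (real n))" N] by simp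
  also have "\<dots> \<le> K"
    by (rule Liminf_le) (auto intro!: eventually_sequentiallyI[of 1] bound)
  finally show ?thesis .
qed

lemma nn_integral_has_density:
  assumes "prob_space M" "has_density M X f"
  shows "(\<integral>\<^sup>+ x. ennreal (f x) \<partial>lborel) = 1"
  using distributed_nn_integral[of M lborel X "\<lambda>x. ennreal (f x)" "\<lambda>_. 1"] assms
  by (simp add: has_density_def prob_space.emeasure_space_1)

section \<open>Concavity at the midpoint\<close>

lemma s_concave_midpoint:
  assumes "s_concave s f" "f x > 0" "f y > 0"
  shows "s_mean s (1/2) (f x) (f y) \<le> f ((1/2) *\<^sub>R (x + y))"
proof -
  have "s_mean s (1/2) (f x) (f y) \<le> f ((1 - 1/2) *\<^sub>R x + (1/2) *\<^sub>R y)"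
    using assms unfolding s_concave_def
    by (metis mult_pos_pos half_gt_zero_iff less_numeral_extra(1) field_sum_of_halves less_add_same_cancel1)
  then show ?thesis by (simp add: scaleR_add_right)
qed

lemma s_mean_pos: "a > 0 \<Longrightarrow> b > 0 \<Longrightarrow> s_mean s (1/2) a b > 0"
proof -
  assume "a > 0" "b > 0"
  then have "(1 - 1/2) * a powr u + 1/2 * b powr u > 0" for u :: real
    by (intro add_pos_pos mult_pos_pos) auto
  then have "((1 - 1/2) * a powr u + 1/2 * b powr u) powr (1 / u) > 0" for u :: real
    by (metis powr_gt_zero less_numeral_extra(3))
  with \<open>a > 0\<close> \<open>b > 0\<close> show ?thesis
    by (simp add: s_mean_def less_max_iff_disj)
qed

lemma s_concave_midpoint_pos:
  assumes "s_concave s f" "f x > 0" "f y > 0"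
  shows "0 < f ((1/2) *\<^sub>R (x + y))"
  using s_concave_midpoint[OF assms] s_mean_pos[OF assms(2,3)] by (rule less_le_trans[rotated])

text \<open>
  Raising to the power \<open>s\<close> turns the power mean into an arithmetic mean, so that \<open>s\<close>-concavity becomes ordinary
  convexity (\<open>s < 0\<close>) or concavity (\<open>s > 0\<close>) of \<open>f powr s\<close> in the next two lemmas.
\<close>

lemma s_mean_powr:
  assumes "a > 0" "b > 0" "s \<noteq> 0"
  shows "s_mean (ereal s) (1/2) a b powr s = (a powr s + b powr s) / 2"
proof -
  have "a powr s + b powr s > 0" using assms by (simp add: add_pos_pos)
  then show ?thesis using assms by (simp add: s_mean_def powr_powr field_simps)
qed

lemma s_concave_neg_powr_midpoint:
  assumes "s_concave (ereal s) f" "s < 0" "f x > 0" "f y > 0"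
  shows "2 * f ((1/2) *\<^sub>R (x + y)) powr s \<le> f x powr s + f y powr s"
proof -
  have "f ((1/2) *\<^sub>R (x + y)) powr s \<le> s_mean (ereal s) (1/2) (f x) (f y) powr s"
    using assms s_concave_midpoint[OF assms(1,3,4)] s_mean_pos[OF assms(3,4)]
    by (intro powr_mono2') auto
  then show ?thesis using s_mean_powr[OF assms(3,4), of s] assms(2) by simp
qed

text \<open>
  Truncation commutes with the increasing map \<open>t powr s\<close>, and the minimum of a concave function and
  a constant is concave.
\<close>

lemma s_concave_pos_powr_midpoint:
  assumes "s_concave (ereal s) f" "s > 0" "f x > 0" "f y > 0" "c \<ge> 0"
  shows "min (f x) c powr s + min (f y) c powr s \<le> 2 * min (f ((1/2) *\<^sub>R (x + y))) c powr s"
proof -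
  have *: "min a c powr s = min (a powr s) (c powr s)" if "a > 0" for a
    using that assms(2,5) powr_mono2[of s a c] powr_mono2[of s c a] by (auto simp: min_def)
  have "s_mean (ereal s) (1/2) (f x) (f y) powr s \<le> f ((1/2) *\<^sub>R (x + y)) powr s"
    using assms s_concave_midpoint[OF assms(1,3,4)] s_mean_pos[OF assms(3,4)]
    by (intro powr_mono2) (auto intro: less_imp_le)
  then have "f x powr s + f y powr s \<le> 2 * f ((1/2) *\<^sub>R (x + y)) powr s"
    using s_mean_powr[OF assms(3,4), of s] assms(2) by simp
  then have "min (f x powr s) (c powr s) + min (f y powr s) (c powr s)
      \<le> 2 * min (f ((1/2) *\<^sub>R (x + y)) powr s) (c powr s)"
    by linarith
  then show ?thesis
    unfolding *[OF assms(3)] *[OF assms(4)] *[OF s_concave_midpoint_pos[OF assms(1,3,4)]] .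
qed

text \<open>
  The truncation at \<open>c\<close> makes \<open>ln (c / min f c)\<close> nonnegative. Convexity of this function is concavity of
  \<open>ln f\<close>, but nonnegativity keeps all expectations of it well defined.
\<close>

lemma log_concave_truncated_midpoint:
  assumes "s_concave 0 f" "f x > 0" "f y > 0" "c > 0"
  shows "2 * ln (c / min (f ((1/2) *\<^sub>R (x + y))) c) \<le> ln (c / min (f x) c) + ln (c / min (f y) c)"
proof -
  let ?z = "(1/2) *\<^sub>R (x + y)"
  have pos: "f ?z > 0" by (rule s_concave_midpoint_pos[OF assms(1-3)])
  have "ln (s_mean 0 (1/2) (f x) (f y)) \<le> ln (f ?z)"
    using s_concave_midpoint[OF assms(1-3)] s_mean_pos[OF assms(2,3)] pos by (intro ln_mono) auto
  then have conc: "ln (f x) + ln (f y) \<le> 2 * ln (f ?z)"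
    using assms(2,3) by (simp add: s_mean_def ln_mult ln_powr)
  have min_ln: "ln (c / min a c) = ln c - min (ln a) (ln c)" if "a > 0" for a
    using that assms(4) by (auto simp: ln_div min_def)
  show ?thesis
    unfolding min_ln[OF assms(2)] min_ln[OF assms(3)] min_ln[OF pos] using conc by (simp add: min_def)
qed

section \<open>Weighted Young and Gibbs inequalities\<close>

text \<open>
  Young's inequality with weights \<open>1 + s\<close> and \<open>- s\<close> for \<open>a * b powr s\<close> and \<open>b powr (1 + s)\<close>. It is
  the tangent line bound for the concave function \<open>t powr (1 + s)\<close> at \<open>b\<close>, with equality for \<open>a = b\<close>.
\<close>

lemma tangent_powr_less_1:
  fixes a b s :: real
  assumes "a \<ge> 0" "b > 0" "- 1 < s" "s < 0"
  shows "a powr (1 + s) \<le> (1 + s) * (a * b powr s) + (- s) * b powr (1 + s)"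
proof (cases "a = 0")
  case False
  have "(a * b powr s) powr (1 + s) * (b powr (1 + s)) powr (- s) = a powr (1 + s)"
    using assms False by (simp add: powr_mult powr_powr algebra_simps flip: powr_add)
  then show ?thesis
    using Youngs_inequality_0[of "1 + s" "- s" "a * b powr s" "b powr (1 + s)"] assms False by simp
qed (use assms in \<open>auto intro: mult_nonpos_nonneg\<close>)

text \<open>
  The counterpart for positive \<open>s\<close>, where \<open>t powr (1 + s)\<close> is convex and lies above its tangent at \<open>b\<close>.
\<close>

lemma tangent_powr_greater_1:
  fixes a b s :: real
  assumes "a \<ge> 0" "b \<ge> 0" "s > 0"
  shows "(1 + s) * (a * b powr s) \<le> a powr (1 + s) + s * b powr (1 + s)"
proof (cases "a = 0 \<or> b = 0")
  case False
  have "(a powr (1 + s)) powr (1 / (1 + s)) * (b powr (1 + s)) powr (s / (1 + s)) = a * b powr s"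
    using assms False by (simp add: powr_powr)
  then have "a * b powr s \<le> 1 / (1 + s) * a powr (1 + s) + s / (1 + s) * b powr (1 + s)"
    using Youngs_inequality_0[of "1 / (1 + s)" "s / (1 + s)" "a powr (1 + s)" "b powr (1 + s)"]
      assms False by (simp add: add_divide_distrib[symmetric])
  then have "(1 + s) * (a * b powr s) \<le> (1 + s) * (1 / (1 + s) * a powr (1 + s) + s / (1 + s) * b powr (1 + s))"
    using assms by (intro mult_left_mono) auto
  also have "\<dots> = a powr (1 + s) + s * b powr (1 + s)"
    using assms by (simp add: distrib_left)
  finally show ?thesis .
qed (use assms in auto)

text \<open>
  The limit \<open>s = 0\<close>: the convex function \<open>t * ln t\<close> lies above its tangent at \<open>b\<close>.
\<close>

lemma gibbs_pointwise:
  fixes a b :: real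
  assumes "a \<ge> 0" "b \<ge> 0" "a > 0 \<Longrightarrow> b > 0"
  shows "a * ln b - a * ln a \<le> b - a"
proof (cases "a = 0")
  case False
  then have "a * (ln b - ln a) \<le> a * (b / a - 1)"
    using assms ln_le_minus_one[of "b / a"] by (intro mult_left_mono) (auto simp: ln_div)
  then show ?thesis using False by (simp add: algebra_simps)
qed (use assms in auto)

section \<open>Sums of two identically distributed vectors\<close>

context
  fixes M :: "'a measure" and X Y :: "'a \<Rightarrow> real ^ 'n" and f h :: "real ^ 'n \<Rightarrow> real"
  assumes prob_M: "prob_space M"
    and densX: "has_density M X f" and densY: "has_density M Y f"
    and dens_sum: "has_density M (\<lambda>\<omega>. X \<omega> + Y \<omega>) h"
begin

lemma f_measurable [measurable]: "f \<in> borel_measurable borel"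
  using has_density_measurable[OF densX] by simp

lemma h_measurable [measurable]: "h \<in> borel_measurable borel"
  using has_density_measurable[OF dens_sum] by simp

lemma X_measurable [measurable]: "X \<in> borel_measurable M"
  using densX by (auto simp: has_density_def distributed_def)

lemma Y_measurable [measurable]: "Y \<in> borel_measurable M"
  using densY by (auto simp: has_density_def distributed_def)

lemma f_nonneg: "0 \<le> f x" and h_nonneg: "0 \<le> h x"
  using densX dens_sum by (auto simp: has_density_def)

lemma expectation_X:
  "\<phi> \<in> borel_measurable borel \<Longrightarrow> (\<integral>\<^sup>+ \<omega>. \<phi> (X \<omega>) \<partial>M) = (\<integral>\<^sup>+ x. ennreal (f x) * \<phi> x \<partial>lborel)"
  using distributed_nn_integral[of M lborel X "\<lambda>x. ennreal (f x)" \<phi>] densX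
  by (simp add: has_density_def)

lemma expectation_Y:
  "\<phi> \<in> borel_measurable borel \<Longrightarrow> (\<integral>\<^sup>+ \<omega>. \<phi> (Y \<omega>) \<partial>M) = (\<integral>\<^sup>+ x. ennreal (f x) * \<phi> x \<partial>lborel)"
  using distributed_nn_integral[of M lborel Y "\<lambda>x. ennreal (f x)" \<phi>] densY
  by (simp add: has_density_def)

lemma expectation_midpoint:
  assumes [measurable]: "\<phi> \<in> borel_measurable borel"
  shows "(\<integral>\<^sup>+ \<omega>. \<phi> ((1/2) *\<^sub>R (X \<omega> + Y \<omega>)) \<partial>M) = (\<integral>\<^sup>+ w. ennreal (h w) * \<phi> ((1/2) *\<^sub>R w) \<partial>lborel)"
  using distributed_nn_integral[of M lborel "\<lambda>\<omega>. X \<omega> + Y \<omega>" "\<lambda>x. ennreal (h x)" "\<lambda>w. \<phi> ((1/2) *\<^sub>R w)"] dens_sum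
  by (simp add: has_density_def)

lemma AE_pos: "AE \<omega> in M. f (X \<omega>) > 0 \<and> f (Y \<omega>) > 0"
proof -
  have 0: "(\<integral>\<^sup>+ x. ennreal (f x) * indicator {x. f x = 0} x \<partial>lborel) = 0"
    by (rule nn_integral_0_iff_AE[THEN iffD2]) (auto simp: indicator_def)
  have "(\<integral>\<^sup>+ \<omega>. indicator {x. f x = 0} (X \<omega>) \<partial>M) = 0" "(\<integral>\<^sup>+ \<omega>. indicator {x. f x = 0} (Y \<omega>) \<partial>M) = 0"
    using expectation_X[of "indicator {x. f x = 0}"] expectation_Y[of "indicator {x. f x = 0}"] 0
    by simp_all
  then have "AE \<omega> in M. f (X \<omega>) \<noteq> 0" "AE \<omega> in M. f (Y \<omega>) \<noteq> 0"
    by (simp_all add: nn_integral_0_iff_AE indicator_eq_0_iff)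
  then show ?thesis
    by eventually_elim (auto simp: less_le f_nonneg)
qed

lemma expectation_average:
  assumes [measurable]: "\<phi> \<in> borel_measurable borel"
  shows "(\<integral>\<^sup>+ \<omega>. \<phi> (X \<omega>) + \<phi> (Y \<omega>) \<partial>M) = 2 * (\<integral>\<^sup>+ x. ennreal (f x) * \<phi> x \<partial>lborel)"
  by (simp add: nn_integral_add expectation_X expectation_Y mult_2)

text \<open>
  Only the two marginals enter the right-hand side, so no assumption on the joint law is needed:
  the convexity inequality holds pointwise at \<open>(X \<omega>, Y \<omega>)\<close>, almost surely inside the support of \<open>f\<close>, and is
  integrated over \<open>\<omega>\<close>.
\<close>

lemma midpoint_convex_le:
  assumes [measurable]: "\<phi> \<in> borel_measurable borel"
    and conv: "\<And>x y. f x > 0 \<Longrightarrow> f y > 0 \<Longrightarrow> 2 * \<phi> ((1/2) *\<^sub>R (x + y)) \<le> \<phi> x + \<phi> y"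
  shows "(\<integral>\<^sup>+ w. ennreal (h w) * \<phi> ((1/2) *\<^sub>R w) \<partial>lborel) \<le> (\<integral>\<^sup>+ x. ennreal (f x) * \<phi> x \<partial>lborel)"
proof -
  have "2 * (\<integral>\<^sup>+ \<omega>. \<phi> ((1/2) *\<^sub>R (X \<omega> + Y \<omega>)) \<partial>M) = (\<integral>\<^sup>+ \<omega>. 2 * \<phi> ((1/2) *\<^sub>R (X \<omega> + Y \<omega>)) \<partial>M)"
    by (simp add: nn_integral_cmult)
  also have "\<dots> \<le> (\<integral>\<^sup>+ \<omega>. \<phi> (X \<omega>) + \<phi> (Y \<omega>) \<partial>M)"
    by (intro nn_integral_mono_AE eventually_mono[OF AE_pos]) (auto intro: conv)
  finally show ?thesis
    by (simp add: expectation_average expectation_midpoint ennreal_2_mult_le_iff)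
qed

lemma midpoint_concave_ge:
  assumes [measurable]: "\<phi> \<in> borel_measurable borel"
    and conc: "\<And>x y. f x > 0 \<Longrightarrow> f y > 0 \<Longrightarrow> \<phi> x + \<phi> y \<le> 2 * \<phi> ((1/2) *\<^sub>R (x + y))"
  shows "(\<integral>\<^sup>+ x. ennreal (f x) * \<phi> x \<partial>lborel) \<le> (\<integral>\<^sup>+ w. ennreal (h w) * \<phi> ((1/2) *\<^sub>R w) \<partial>lborel)"
proof -
  have "(\<integral>\<^sup>+ \<omega>. \<phi> (X \<omega>) + \<phi> (Y \<omega>) \<partial>M) \<le> (\<integral>\<^sup>+ \<omega>. 2 * \<phi> ((1/2) *\<^sub>R (X \<omega> + Y \<omega>)) \<partial>M)"
    by (intro nn_integral_mono_AE eventually_mono[OF AE_pos]) (auto intro: conc)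
  also have "\<dots> = 2 * (\<integral>\<^sup>+ \<omega>. \<phi> ((1/2) *\<^sub>R (X \<omega> + Y \<omega>)) \<partial>M)"
    by (simp add: nn_integral_cmult)
  finally show ?thesis
    by (simp add: expectation_average expectation_midpoint ennreal_2_mult_le_iff)
qed

text \<open>
  The support of \<open>f\<close> is closed under midpoints. Applied to the indicator of its complement, which is therefore
  midpoint convex on the support in a trivial way, \<open>midpoint_convex_le\<close> shows that \<open>(X + Y) / 2\<close>
  almost surely stays in the support.
\<close>

lemma AE_sum_in_support:
  assumes "s_concave s f"
  shows "AE w in lborel. h w > 0 \<longrightarrow> f ((1/2) *\<^sub>R w) > 0"
proof -
  have "(\<integral>\<^sup>+ w. ennreal (h w) * indicator {x. f x = 0} ((1/2) *\<^sub>R w) \<partial>lborel)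
      \<le> (\<integral>\<^sup>+ x. ennreal (f x) * indicator {x. f x = 0} x \<partial>lborel)"
    using s_concave_midpoint_pos[OF assms]
    by (intro midpoint_convex_le) (auto simp: indicator_def less_le)
  also have "\<dots> = 0"
    by (rule nn_integral_0_iff_AE[THEN iffD2]) (auto simp: indicator_def)
  finally have "AE w in lborel. ennreal (h w) * indicator {x. f x = 0} ((1/2) *\<^sub>R w) = 0"
    by (simp add: nn_integral_0_iff_AE)
  then show ?thesis
    by eventually_elim (auto simp: less_le f_nonneg indicator_def split: if_splits)
qed

section \<open>Power integrals\<close>

text \<open>
  Integrating Young's inequality for \<open>h\<close> and \<open>q\<close> bounds the left-hand side by
  \<open>(1 + s) * \<integral> h * q powr s - s * \<integral> q powr (1 + s)\<close>. By convexity of \<open>f powr s\<close> the cross term is at most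
  \<open>\<integral> q powr (1 + s)\<close>, which is the right-hand side, and the weights add up to \<open>1\<close>.
  All terms are added and none is cancelled, so the integrals may be infinite.
\<close>

lemma powr_integral_le:
  assumes "s_concave (ereal s) f" "- 1 < s" "s < 0"
  shows "(\<integral>\<^sup>+ w. ennreal (h w powr (1 + s)) \<partial>lborel)
    \<le> ennreal ((2 ^ CARD('n)) powr (- s)) * (\<integral>\<^sup>+ x. ennreal (f x powr (1 + s)) \<partial>lborel)"
proof -
  let ?K = "2 ^ CARD('n) :: real"
  let ?q = "\<lambda>w. f ((1/2) *\<^sub>R w) / ?K"
  let ?F = "\<integral>\<^sup>+ x. ennreal (f x powr (1 + s)) \<partial>lborel"
  have q_powr: "?q w powr s = ?K powr (- s) * f ((1/2) *\<^sub>R w) powr s" for w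
    using f_nonneg powr_minus_divide[of ?K s] by (simp add: powr_divide)
  have "(\<integral>\<^sup>+ w. ennreal (h w) * ennreal (f ((1/2) *\<^sub>R w) powr s) \<partial>lborel)
      \<le> (\<integral>\<^sup>+ x. ennreal (f x) * ennreal (f x powr s) \<partial>lborel)"
    using s_concave_neg_powr_midpoint[OF assms(1,3)]
    by (intro midpoint_convex_le)
      (auto simp flip: ennreal_plus ennreal_numeral ennreal_mult' intro!: ennreal_leI)
  also have "\<dots> = ?F"
    using f_nonneg by (intro nn_integral_cong)
      (auto simp: powr_add powr_one ennreal_mult'[symmetric] simp flip: ennreal_mult)
  finally have mid: "(\<integral>\<^sup>+ w. ennreal (h w) * ennreal (f ((1/2) *\<^sub>R w) powr s) \<partial>lborel) \<le> ?F" .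
  have split: "ennreal (a * (b * c) + d * e) = ennreal a * (ennreal b * ennreal c) + ennreal d * ennreal e"
    if "a \<ge> 0" "b \<ge> 0" "c \<ge> 0" "d \<ge> 0" "e \<ge> 0" for a b c d e
    using that by (simp add: ennreal_plus ennreal_mult)
  have "(\<integral>\<^sup>+ w. ennreal (h w powr (1 + s)) \<partial>lborel)
      \<le> (\<integral>\<^sup>+ w. ennreal ((1 + s) * ?K powr (- s)) * (ennreal (h w) * ennreal (f ((1/2) *\<^sub>R w) powr s))
            + ennreal (- s) * ennreal (?q w powr (1 + s)) \<partial>lborel)"
  proof (rule nn_integral_mono_AE)
    show "AE w in lborel. ennreal (h w powr (1 + s))
        \<le> ennreal ((1 + s) * ?K powr (- s)) * (ennreal (h w) * ennreal (f ((1/2) *\<^sub>R w) powr s))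
            + ennreal (- s) * ennreal (?q w powr (1 + s))"
      using AE_sum_in_support[OF assms(1)]
    proof eventually_elim
      case (elim w)
      have "h w powr (1 + s) \<le> (1 + s) * (h w * ?q w powr s) + (- s) * ?q w powr (1 + s)"
      proof (cases "h w = 0")
        case False
        then show ?thesis
          using elim h_nonneg[of w] assms by (intro tangent_powr_less_1) (auto simp: less_le)
      qed (use assms in \<open>auto intro: mult_nonpos_nonneg\<close>)
      then have "ennreal (h w powr (1 + s))
          \<le> ennreal ((1 + s) * ?K powr (- s) * (h w * f ((1/2) *\<^sub>R w) powr s) + (- s) * ?q w powr (1 + s))"
        unfolding q_powr by (intro ennreal_leI) (simp add: mult_ac)
      also have "\<dots> = ennreal ((1 + s) * ?K powr (- s)) * (ennreal (h w) * ennreal (f ((1/2) *\<^sub>R w) powr s))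
            + ennreal (- s) * ennreal (?q w powr (1 + s))"
        using assms h_nonneg[of w] by (intro split) auto
      finally show ?case .
    qed
  qed
  also have "\<dots> = ennreal ((1 + s) * ?K powr (- s)) * (\<integral>\<^sup>+ w. ennreal (h w) * ennreal (f ((1/2) *\<^sub>R w) powr s) \<partial>lborel)
      + ennreal (- s) * (ennreal (?K powr (- s)) * ?F)"
    by (simp add: nn_integral_add nn_integral_cmult dilated_powr_integral f_nonneg)
  also have "\<dots> \<le> ennreal ((1 + s) * ?K powr (- s)) * ?F + ennreal (- s) * (ennreal (?K powr (- s)) * ?F)"
    by (intro add_right_mono mult_left_mono mid) auto
  also have "\<dots> = ennreal (?K powr (- s)) * ?F"
  proof -
    have weights: "ennreal ((1 + s) * ?K powr (- s)) + ennreal (- s) * ennreal (?K powr (- s)) = ennreal (?K powr (- s))"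
    proof -
      have "ennreal ((1 + s) * ?K powr (- s)) + ennreal (- s) * ennreal (?K powr (- s))
          = ennreal ((1 + s) * ?K powr (- s)) + ennreal ((- s) * ?K powr (- s))"
        using assms by (subst ennreal_mult) auto
      also have "\<dots> = ennreal ((1 + s) * ?K powr (- s) + (- s) * ?K powr (- s))"
        using assms by (intro ennreal_plus[symmetric] mult_nonneg_nonneg) auto
      finally show ?thesis by (simp add: algebra_simps)
    qed
    have "ennreal ((1 + s) * ?K powr (- s)) * ?F + ennreal (- s) * (ennreal (?K powr (- s)) * ?F)
        = (ennreal ((1 + s) * ?K powr (- s)) + ennreal (- s) * ennreal (?K powr (- s))) * ?F"
      by (simp only: distrib_right mult.assoc)
    then show ?thesis unfolding weights .
  qed
  finally show ?thesis .
qed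

text \<open>
  With \<open>Q = \<integral> q powr (1 + s)\<close> and \<open>H = \<integral> h powr (1 + s)\<close>, concavity of \<open>f powr s\<close> and Young's inequality give
  \<open>(1 + s) * Q \<le> H + s * Q\<close>. Cancelling \<open>s * Q\<close> requires \<open>Q\<close> to be finite. This holds for the
  truncated density \<open>g = min f n\<close>, because \<open>g powr (1 + s) \<le> n powr s * f\<close>.
\<close>

lemma powr_integral_ge:
  assumes "s_concave (ereal s) f" "s > 0"
  shows "ennreal ((2 ^ CARD('n)) powr (- s)) * (\<integral>\<^sup>+ x. ennreal (f x powr (1 + s)) \<partial>lborel)
    \<le> (\<integral>\<^sup>+ w. ennreal (h w powr (1 + s)) \<partial>lborel)"
proof -
  let ?K = "2 ^ CARD('n) :: real"
  let ?H = "\<integral>\<^sup>+ w. ennreal (h w powr (1 + s)) \<partial>lborel"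
  have trunc: "(\<integral>\<^sup>+ x. ennreal (?K powr (- s)) * ennreal (min (f x) (real n) powr (1 + s)) \<partial>lborel) \<le> ?H"
    if "n \<ge> 1" for n :: nat
  proof -
    define g where "g x = min (f x) (real n)" for x
    have [measurable]: "g \<in> borel_measurable borel" unfolding g_def by simp
    have g: "0 \<le> g x" "g x \<le> f x" "g x \<le> real n" for x using f_nonneg by (auto simp: g_def)
    let ?q = "\<lambda>w. g ((1/2) *\<^sub>R w) / ?K"
    let ?G = "\<integral>\<^sup>+ x. ennreal (g x powr (1 + s)) \<partial>lborel"
    let ?Q = "ennreal (?K powr (- s)) * ?G"
    have g_le: "ennreal (g x powr (1 + s)) \<le> ennreal (f x) * ennreal (g x powr s)" for x
    proof -
      have "g x powr (1 + s) \<le> f x * g x powr s"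
        using g[of x] by (cases "g x = 0") (auto simp: powr_add powr_one intro!: mult_right_mono)
      then show ?thesis using f_nonneg[of x] by (simp flip: ennreal_mult)
    qed
    have "?G \<le> (\<integral>\<^sup>+ x. ennreal (f x) * ennreal (g x powr s) \<partial>lborel)"
      by (intro nn_integral_mono g_le)
    also have "\<dots> \<le> (\<integral>\<^sup>+ w. ennreal (h w) * ennreal (g ((1/2) *\<^sub>R w) powr s) \<partial>lborel)"
      using s_concave_pos_powr_midpoint[OF assms(1,2), of _ _ "real n"]
      by (intro midpoint_concave_ge)
        (auto simp: g_def simp flip: ennreal_plus ennreal_numeral ennreal_mult' intro!: ennreal_leI)
    finally have G_le: "?G \<le> (\<integral>\<^sup>+ w. ennreal (h w) * ennreal (g ((1/2) *\<^sub>R w) powr s) \<partial>lborel)" .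
    have "?G \<le> (\<integral>\<^sup>+ x. ennreal (f x) * ennreal (real n powr s) \<partial>lborel)"
    proof (intro nn_integral_mono)
      fix x
      have "g x powr s \<le> real n powr s" using g[of x] assms(2) by (intro powr_mono2) auto
      then show "ennreal (g x powr (1 + s)) \<le> ennreal (f x) * ennreal (real n powr s)"
        using g_le[of x] by (meson order_trans mult_left_mono ennreal_leI zero_le)
    qed
    also have "\<dots> = ennreal (real n powr s)"
      using nn_integral_has_density[OF prob_M densX] by (simp add: nn_integral_multc)
    finally have "?Q \<noteq> \<infinity>"
      by (auto simp: ennreal_mult_eq_top_iff top_unique)
    have q_powr: "?q w powr s = ?K powr (- s) * g ((1/2) *\<^sub>R w) powr s" for w
      using g powr_minus_divide[of ?K s] by (simp add: powr_divide)
    have "ennreal (1 + s) * ?Q \<le> ennreal (1 + s) * (ennreal (?K powr (- s)) *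
        (\<integral>\<^sup>+ w. ennreal (h w) * ennreal (g ((1/2) *\<^sub>R w) powr s) \<partial>lborel))"
      by (intro mult_left_mono G_le) auto
    also have "\<dots> = (\<integral>\<^sup>+ w. ennreal (1 + s) * (ennreal (?K powr (- s)) *
        (ennreal (h w) * ennreal (g ((1/2) *\<^sub>R w) powr s))) \<partial>lborel)"
      by (simp add: nn_integral_cmult)
    also have "\<dots> \<le> (\<integral>\<^sup>+ w. ennreal (h w powr (1 + s)) + ennreal s * ennreal (?q w powr (1 + s)) \<partial>lborel)"
    proof (intro nn_integral_mono)
      fix w
      have "(1 + s) * (h w * ?q w powr s) \<le> h w powr (1 + s) + s * ?q w powr (1 + s)"
        using h_nonneg g assms(2) by (intro tangent_powr_greater_1) auto
      then have "(1 + s) * (?K powr (- s) * (h w * g ((1/2) *\<^sub>R w) powr s)) \<le> h w powr (1 + s) + s * ?q w powr (1 + s)"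
        unfolding q_powr by (simp add: mult_ac)
      then show "ennreal (1 + s) * (ennreal (?K powr (- s)) * (ennreal (h w) * ennreal (g ((1/2) *\<^sub>R w) powr s)))
          \<le> ennreal (h w powr (1 + s)) + ennreal s * ennreal (?q w powr (1 + s))"
        using assms(2) h_nonneg[of w] by (simp flip: ennreal_plus ennreal_mult)
    qed
    also have "\<dots> = ?H + ennreal s * ?Q"
      by (simp add: nn_integral_add nn_integral_cmult dilated_powr_integral g)
    finally have "ennreal s * ?Q + ?Q \<le> ennreal s * ?Q + ?H"
      using assms(2) by (simp add: distrib_right add.commute)
    then have "?Q \<le> ?H"
      using \<open>?Q \<noteq> \<infinity>\<close> by (simp add: ennreal_add_left_cancel_le ennreal_mult_eq_top_iff)
    then show ?thesis by (simp add: nn_integral_cmult g_def)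
  qed
  have "(\<integral>\<^sup>+ x. ennreal (?K powr (- s)) * ennreal (f x powr (1 + s)) \<partial>lborel) \<le> ?H"
    by (rule nn_integral_le_if_truncations_le[where F="\<lambda>t. ennreal (?K powr (- s)) * ennreal (t powr (1 + s))"])
      (use trunc in auto)
  then show ?thesis by (simp add: nn_integral_cmult)
qed

lemma renyi_entropy_density_sum_le_real:
  assumes "s_concave (ereal s) f" "- 1 < s" "s \<noteq> 0"
  shows "renyi_entropy_density (1 + ereal s) h \<le> renyi_entropy_density (1 + ereal s) f + ereal (ln (2 ^ CARD('n)))"
proof -
  let ?K = "2 ^ CARD('n) :: real"
  let ?H = "\<integral>\<^sup>+ w. ennreal (h w powr (1 + s)) \<partial>lborel"
  let ?F = "\<integral>\<^sup>+ w. ennreal (f w powr (1 + s)) \<partial>lborel"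
  have entropy: "renyi_entropy_density (1 + ereal s) u = ereal (- 1 / s) * ext_ln (\<integral>\<^sup>+ w. ennreal (u w powr (1 + s)) \<partial>lborel)"
    for u :: "real ^ 'n \<Rightarrow> real"
  proof -
    have "1 + ereal s = ereal (1 + s)" by simp
    moreover have "ereal (1 + s) \<noteq> 0" "ereal (1 + s) \<noteq> 1" using assms(2,3) by auto
    ultimately show ?thesis by (simp add: renyi_entropy_density_def add.commute)
  qed
  have scaled: "ext_ln (ennreal (?K powr (- s)) * ?F) = ereal (- s * ln ?K) + ext_ln ?F"
    by (subst ext_ln_cmult) (simp_all add: ln_powr)
  have "ereal (- 1 / s) * ext_ln ?H \<le> ereal (- 1 / s) * ext_ln (ennreal (?K powr (- s)) * ?F)"
  proof (cases "s < 0")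
    case True
    then show ?thesis
      using powr_integral_le[OF assms(1,2)] by (intro ereal_mult_left_mono ext_ln_mono) (auto simp: field_simps)
  next
    case False
    then have "s > 0" using assms(3) by simp
    then have "ext_ln (ennreal (?K powr (- s)) * ?F) \<le> ext_ln ?H"
      using powr_integral_ge[OF assms(1)] by (intro ext_ln_mono)
    then have "ereal (1 / s) * ext_ln (ennreal (?K powr (- s)) * ?F) \<le> ereal (1 / s) * ext_ln ?H"
      using \<open>s > 0\<close> by (intro ereal_mult_left_mono) auto
    moreover have "ereal (- 1 / s) * z = - (ereal (1 / s) * z)" for z
      by (simp flip: ereal_mult_minus_left)
    ultimately show ?thesis by simp
  qed
  also have "\<dots> = ereal (- 1 / s) * ext_ln ?F + ereal (ln ?K)"
    unfolding scaled using assms(3) by (cases "ext_ln ?F") (auto simp: field_simps)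
  finally show ?thesis unfolding entropy .
qed

section \<open>Essential suprema\<close>

text \<open>
  If \<open>c\<close> is below the essential supremum of \<open>f\<close>, let \<open>m\<close> be the measure of the superlevel set at \<open>c\<close>,
  which is positive and, by Markov's inequality, finite. That set carries mass at least \<open>c * m\<close> under \<open>f\<close>. If one of two points of
  the support lies in it, so does their midpoint, hence its dilate by \<open>2\<close> carries at least as much mass under \<open>h\<close>;
  but this mass is at most \<open>2 ^ d * m\<close> times the essential supremum of \<open>h\<close>.
\<close>

lemma renyi_entropy_density_sum_le_infinity:
  assumes "s_concave \<infinity> f"
  shows "renyi_entropy_density \<infinity> h \<le> renyi_entropy_density \<infinity> f + ereal (ln (2 ^ CARD('n)))"
proof -
  let ?K = "2 ^ CARD('n) :: real"
  let ?S = "esssup lborel (\<lambda>x. ennreal (f x))" and ?T = "esssup lborel (\<lambda>x. ennreal (h x))"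
  have "c \<le> ennreal ?K * ?T" if "c < ?S" for c
  proof (cases "c = 0")
    case False
    let ?A = "{x. ennreal (f x) > c}"
    let ?m = "emeasure lborel ?A"
    have m_pos: "?m > 0" using esssup_pos_measure[OF _ that] by simp
    have "c * ?m = (\<integral>\<^sup>+ x. c * indicator ?A x \<partial>lborel)"
      by (simp add: nn_integral_cmult_indicator)
    also have "\<dots> \<le> (\<integral>\<^sup>+ x. ennreal (f x) * indicator ?A x \<partial>lborel)"
      by (intro nn_integral_mono) (auto simp: indicator_def)
    finally have lower: "c * ?m \<le> (\<integral>\<^sup>+ x. ennreal (f x) * indicator ?A x \<partial>lborel)" .
    also have "\<dots> \<le> (\<integral>\<^sup>+ x. ennreal (f x) \<partial>lborel)"
      by (intro nn_integral_mono) (auto simp: indicator_def)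
    finally have "c * ?m \<le> 1"
      by (simp add: nn_integral_has_density[OF prob_M densX])
    then have m_fin: "?m \<noteq> \<infinity>"
      using False by (auto simp: ennreal_mult_top top_unique)
    have max: "max (f x) (f y) \<le> f ((1/2) *\<^sub>R (x + y))" if "f x > 0" "f y > 0" for x y
      using s_concave_midpoint[OF assms that] by (simp add: s_mean_def)
    note lower
    also have "(\<integral>\<^sup>+ x. ennreal (f x) * indicator ?A x \<partial>lborel)
        \<le> (\<integral>\<^sup>+ w. ennreal (h w) * indicator ?A ((1/2) *\<^sub>R w) \<partial>lborel)"
    proof (intro midpoint_concave_ge)
      fix x y assume "f x > 0" "f y > 0"
      then have "ennreal (f x) \<le> ennreal (f ((1/2) *\<^sub>R (x + y)))" "ennreal (f y) \<le> ennreal (f ((1/2) *\<^sub>R (x + y)))"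
        using max[of x y] by (auto intro!: ennreal_leI)
      then show "indicator ?A x + indicator ?A y \<le> 2 * (indicator ?A ((1/2) *\<^sub>R (x + y)) :: ennreal)"
        by (auto simp: indicator_def)
    qed simp
    also have "\<dots> \<le> (\<integral>\<^sup>+ w. ?T * indicator ?A ((1/2) *\<^sub>R w) \<partial>lborel)"
      using esssup_AE[of "\<lambda>x. ennreal (h x)" lborel]
      by (intro nn_integral_mono_AE) (auto elim!: eventually_mono intro: mult_right_mono)
    also have "\<dots> = ennreal ?K * (?T * ?m)"
      by (subst nn_integral_dilate[where F="\<lambda>x. ?T * indicator ?A x"]) (simp_all add: nn_integral_cmult_indicator)
    finally have "?m * c \<le> ?m * (ennreal ?K * ?T)" by (simp add: mult_ac)
    then show ?thesis using m_pos m_fin ennreal_mult_le_mult_iff[of ?m] by auto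
  qed simp
  then have "?S \<le> ennreal ?K * ?T" by (rule dense_le)
  then have "ext_ln ?S \<le> ereal (ln ?K) + ext_ln ?T"
    using ext_ln_mono by (simp add: ext_ln_cmult[of ?K, symmetric])
  then have "- ext_ln ?T \<le> - ext_ln ?S + ereal (ln ?K)"
    by (cases "ext_ln ?S"; cases "ext_ln ?T") auto
  then show ?thesis by (simp add: renyi_entropy_density_def)
qed

section \<open>Shannon entropy\<close>

text \<open>
  Convexity of \<open>ln (n / g)\<close> bounds the cross term by \<open>\<integral> f * ln (n / g)\<close>. Formally this is
  \<open>ln n - \<integral> f * ln g\<close>, and \<open>f * ln g\<close> is at least \<open>g * ln g\<close> where \<open>f \<ge> 1\<close> and equal to \<open>f * ln f\<close>
  where \<open>f < 1\<close>. The negative terms are moved to the other side so that everything is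
  nonnegative.
\<close>

lemma truncated_cross_entropy_le:
  fixes n :: nat
  assumes "s_concave 0 f" "n \<ge> 1"
  defines "g \<equiv> \<lambda>x. min (f x) (real n)"
  shows "(\<integral>\<^sup>+ w. ennreal (h w) * ennreal (ln (real n / g ((1/2) *\<^sub>R w))) \<partial>lborel)
      + (\<integral>\<^sup>+ x. ennreal (g x * ln (g x)) \<partial>lborel)
    \<le> ennreal (ln (real n)) + (\<integral>\<^sup>+ x. ennreal (- (f x * ln (f x))) \<partial>lborel)"
proof -
  have [measurable]: "g \<in> borel_measurable borel" unfolding g_def by simp
  have nonneg: "0 \<le> ln (real n / g x)" if "f x > 0" for x
    using that assms(2) by (auto simp: g_def min_def)
  have "(\<integral>\<^sup>+ w. ennreal (h w) * ennreal (ln (real n / g ((1/2) *\<^sub>R w))) \<partial>lborel)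
      \<le> (\<integral>\<^sup>+ x. ennreal (f x) * ennreal (ln (real n / g x)) \<partial>lborel)"
  proof (intro midpoint_convex_le)
    fix x y assume pos: "f x > 0" "f y > 0"
    have "2 * ln (real n / g ((1/2) *\<^sub>R (x + y))) \<le> ln (real n / g x) + ln (real n / g y)"
      unfolding g_def using assms(2) by (intro log_concave_truncated_midpoint[OF assms(1) pos]) simp
    then show "2 * ennreal (ln (real n / g ((1/2) *\<^sub>R (x + y)))) \<le> ennreal (ln (real n / g x)) + ennreal (ln (real n / g y))"
      using pos[THEN nonneg] nonneg[OF s_concave_midpoint_pos[OF assms(1) pos]]
      by (simp add: ennreal_leI flip: ennreal_plus ennreal_numeral ennreal_mult)
  qed simp
  then have "(\<integral>\<^sup>+ w. ennreal (h w) * ennreal (ln (real n / g ((1/2) *\<^sub>R w))) \<partial>lborel)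
      + (\<integral>\<^sup>+ x. ennreal (g x * ln (g x)) \<partial>lborel)
      \<le> (\<integral>\<^sup>+ x. ennreal (f x) * ennreal (ln (real n / g x)) + ennreal (g x * ln (g x)) \<partial>lborel)"
    by (simp add: nn_integral_add add_right_mono)
  also have "\<dots> \<le> (\<integral>\<^sup>+ x. ennreal (ln (real n)) * ennreal (f x) + ennreal (- (f x * ln (f x))) \<partial>lborel)"
  proof (intro nn_integral_mono)
    fix x
    consider "f x = 0" | "0 < f x" "f x < 1" | "f x \<ge> 1" using f_nonneg[of x] by linarith
    then show "ennreal (f x) * ennreal (ln (real n / g x)) + ennreal (g x * ln (g x))
        \<le> ennreal (ln (real n)) * ennreal (f x) + ennreal (- (f x * ln (f x)))"
    proof cases
      case 2
      then have "g x = f x" using assms(2) by (simp add: g_def)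
      moreover have "f x * ln (f x) \<le> 0" using 2 by (simp add: mult_nonneg_nonpos)
      ultimately show ?thesis
        using 2 assms(2) nonneg[of x]
        by (simp add: ennreal_neg ln_div algebra_simps flip: ennreal_plus ennreal_mult)
    next
      case 3
      then have g1: "1 \<le> g x" "g x \<le> f x" using assms(2) by (auto simp: g_def)
      then have "g x * ln (g x) \<le> f x * ln (g x)" by (intro mult_right_mono) auto
      then show ?thesis
        using 3 g1 assms(2) nonneg[of x]
        by (simp add: ennreal_neg ln_div algebra_simps flip: ennreal_plus ennreal_mult)
    qed (simp add: g_def)
  qed
  also have "\<dots> = ennreal (ln (real n)) + (\<integral>\<^sup>+ x. ennreal (- (f x * ln (f x))) \<partial>lborel)"
    by (simp add: nn_integral_add nn_integral_cmult nn_integral_has_density[OF prob_M densX])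
  finally show ?thesis .
qed

text \<open>
  Gibbs' inequality for the density \<open>h\<close> and the subprobability density \<open>q w = g (w / 2) / 2 ^ d\<close>, with
  \<open>- ln q\<close> written as \<open>ln (n / g) + d * ln 2 - ln n\<close>. The second bound is a coarser one without
  \<open>\<integral> (h * ln h)\<^sup>+\<close>; it is the one that shows that the negative part of \<open>h * ln h\<close> is integrable.
\<close>

lemma gibbs_truncated:
  fixes n :: nat
  assumes "s_concave 0 f" "n \<ge> 1"
  defines "g \<equiv> \<lambda>x. min (f x) (real n)"
  shows "ennreal (ln (real n)) + (\<integral>\<^sup>+ w. ennreal (- (h w * ln (h w))) \<partial>lborel)
    \<le> (\<integral>\<^sup>+ w. ennreal (h w) * ennreal (ln (real n / g ((1/2) *\<^sub>R w))) \<partial>lborel)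
      + ennreal (ln (2 ^ CARD('n))) + (\<integral>\<^sup>+ w. ennreal (h w * ln (h w)) \<partial>lborel)" (is ?main)
    and "(\<integral>\<^sup>+ w. ennreal (- (h w * ln (h w))) \<partial>lborel)
    \<le> (\<integral>\<^sup>+ w. ennreal (h w) * ennreal (ln (real n / g ((1/2) *\<^sub>R w))) \<partial>lborel)
      + ennreal (ln (2 ^ CARD('n))) + 1" (is ?crude)
proof -
  let ?K = "2 ^ CARD('n) :: real"
  let ?C = "\<integral>\<^sup>+ w. ennreal (h w) * ennreal (ln (real n / g ((1/2) *\<^sub>R w))) \<partial>lborel"
  let ?L = "\<lambda>w. ln (real n / g ((1/2) *\<^sub>R w))"
  let ?q = "\<lambda>w. g ((1/2) *\<^sub>R w) / ?K"
  have [measurable]: "g \<in> borel_measurable borel" unfolding g_def by simp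
  have g: "0 \<le> g x" "g x \<le> f x" for x using f_nonneg by (auto simp: g_def)
  have int_h: "(\<integral>\<^sup>+ w. ennreal (h w) \<partial>lborel) = 1"
    by (rule nn_integral_has_density[OF prob_M dens_sum])
  have "(\<integral>\<^sup>+ w. ennreal (?q w) \<partial>lborel) \<le> (\<integral>\<^sup>+ w. ennreal (f ((1/2) *\<^sub>R w) / ?K) \<partial>lborel)"
    using g by (intro nn_integral_mono ennreal_leI divide_right_mono) auto
  also have "\<dots> = ennreal ?K * (ennreal (1 / ?K) * (\<integral>\<^sup>+ x. ennreal (f x) \<partial>lborel))"
    by (subst nn_integral_dilate[where F="\<lambda>x. ennreal (f x / 2 ^ CARD('n))"])
      (simp_all add: f_nonneg ennreal_mult'[symmetric] flip: nn_integral_cmult)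
  also have "\<dots> = 1"
    by (simp add: nn_integral_has_density[OF prob_M densX] flip: ennreal_mult)
  finally have int_q: "(\<integral>\<^sup>+ w. ennreal (?q w) \<partial>lborel) \<le> 1" .
  \<comment> \<open>Gibbs' inequality without logarithms of \<open>q\<close>. Where \<open>h\<close> is positive the sign of \<open>?L\<close> allows the passage to \<open>ennreal\<close>.\<close>
  have key: "AE w in lborel. (h w > 0 \<longrightarrow> 0 \<le> ?L w) \<and>
      h w * ln (real n) + h w \<le> h w * ?L w + h w * ln ?K + h w * ln (h w) + ?q w"
    using AE_sum_in_support[OF assms(1)]
  proof eventually_elim
    case (elim w)
    show ?case
    proof (cases "h w = 0")
      case False
      then have "h w > 0" using h_nonneg[of w] by simp
      then have pos: "g ((1/2) *\<^sub>R w) > 0" using elim assms(2) by (simp add: g_def)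
      have "ln (?q w) = ln (real n) - ?L w - ln ?K"
        using pos assms(2) by (simp add: ln_div)
      then have "h w * ln (?q w) = h w * ln (real n) - h w * ?L w - h w * ln ?K"
        by (simp only: right_diff_distrib)
      moreover have "h w * ln (?q w) - h w * ln (h w) \<le> ?q w - h w"
        using pos h_nonneg[of w] by (intro gibbs_pointwise) auto
      moreover have "0 \<le> ?L w" using pos assms(2) by (simp add: g_def)
      ultimately show ?thesis by simp
    qed (simp add: g)
  qed
  have lnn: "0 \<le> ln (real n)" using assms(2) by simp
  have lnK: "0 \<le> ln ?K" by simp
  have "ennreal (ln (real n)) + 1 + (\<integral>\<^sup>+ w. ennreal (- (h w * ln (h w))) \<partial>lborel)
     = (\<integral>\<^sup>+ w. ennreal (ln (real n)) * ennreal (h w) + ennreal (h w) + ennreal (- (h w * ln (h w))) \<partial>lborel)"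
    by (simp add: nn_integral_add nn_integral_cmult int_h)
  also have "\<dots> \<le> (\<integral>\<^sup>+ w. ennreal (h w) * ennreal (?L w) + ennreal (ln ?K) * ennreal (h w)
      + ennreal (h w * ln (h w)) + ennreal (?q w) \<partial>lborel)"
  proof (rule nn_integral_mono_AE)
    show "AE w in lborel. ennreal (ln (real n)) * ennreal (h w) + ennreal (h w) + ennreal (- (h w * ln (h w)))
      \<le> ennreal (h w) * ennreal (?L w) + ennreal (ln ?K) * ennreal (h w)
      + ennreal (h w * ln (h w)) + ennreal (?q w)"
      using key
    proof eventually_elim
      case (elim w)
      show ?case
      proof (cases "h w = 0")
        case False
        then have hw: "h w > 0" using h_nonneg[of w] by simp
        then have "0 \<le> h w * ?L w" "0 \<le> ?q w" "0 \<le> ln (real n) * h w" "0 \<le> ln ?K * h w"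
          using elim g lnn lnK by auto
        note nn = this
        have "ennreal (ln (real n)) * ennreal (h w) + ennreal (h w) + ennreal (- (h w * ln (h w)))
            = ennreal (ln (real n) * h w + h w + max 0 (- (h w * ln (h w))))"
          using nn hw lnn by (simp only: ennreal_plus ennreal_mult less_imp_le add_nonneg_nonneg
              max.cobounded1 ennreal_max_0)
        \<comment> \<open>The positive and negative parts of \<open>h * ln h\<close> differ by \<open>h * ln h\<close>.\<close>
        also have "\<dots> \<le> ennreal (h w * ?L w + ln ?K * h w + max 0 (h w * ln (h w)) + ?q w)"
          using elim by (intro ennreal_leI) (simp only: mult.commute, linarith)
        also have "\<dots> = ennreal (h w) * ennreal (?L w) + ennreal (ln ?K) * ennreal (h w)
            + ennreal (h w * ln (h w)) + ennreal (?q w)"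
          using nn hw lnK elim by (simp only: ennreal_plus ennreal_mult less_imp_le add_nonneg_nonneg
              max.cobounded1 ennreal_max_0)
        finally show ?thesis .
      qed simp
    qed
  qed
  also have "\<dots> = ?C + ennreal (ln ?K) + (\<integral>\<^sup>+ w. ennreal (h w * ln (h w)) \<partial>lborel) + (\<integral>\<^sup>+ w. ennreal (?q w) \<partial>lborel)"
    by (simp add: nn_integral_add nn_integral_cmult int_h)
  also have "\<dots> \<le> ?C + ennreal (ln ?K) + (\<integral>\<^sup>+ w. ennreal (h w * ln (h w)) \<partial>lborel) + 1"
    by (intro add_left_mono int_q)
  finally have "1 + (ennreal (ln (real n)) + (\<integral>\<^sup>+ w. ennreal (- (h w * ln (h w))) \<partial>lborel))
      \<le> 1 + (?C + ennreal (ln ?K) + (\<integral>\<^sup>+ w. ennreal (h w * ln (h w)) \<partial>lborel))"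
    by (simp only: add_ac)
  then show ?main by (subst (asm) ennreal_add_left_cancel_le) simp
  have "(\<integral>\<^sup>+ w. ennreal (- (h w * ln (h w))) \<partial>lborel)
     \<le> (\<integral>\<^sup>+ w. ennreal (h w) * ennreal (?L w) + ennreal (ln ?K) * ennreal (h w) + ennreal (?q w) \<partial>lborel)"
  proof (rule nn_integral_mono_AE)
    show "AE w in lborel. ennreal (- (h w * ln (h w)))
      \<le> ennreal (h w) * ennreal (?L w) + ennreal (ln ?K) * ennreal (h w) + ennreal (?q w)"
      using key
    proof eventually_elim
      case (elim w)
      show ?case
      proof (cases "h w = 0")
        case False
        then have hw: "h w > 0" using h_nonneg[of w] by simp
        then have "0 \<le> h w * ?L w" "0 \<le> ?q w" "0 \<le> h w * ln (real n)" "0 \<le> ln ?K * h w"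
          using elim g lnn lnK by auto
        then have "ennreal (- (h w * ln (h w))) \<le> ennreal (h w * ?L w + ln ?K * h w + ?q w)"
          using elim hw by (intro ennreal_leI) (simp add: mult.commute)
        also have "\<dots> = ennreal (h w) * ennreal (?L w) + ennreal (ln ?K) * ennreal (h w) + ennreal (?q w)"
          using \<open>0 \<le> h w * ?L w\<close> \<open>0 \<le> ?q w\<close> \<open>0 \<le> ln ?K * h w\<close> elim hw lnK
          by (simp only: ennreal_plus ennreal_mult less_imp_le add_nonneg_nonneg)
        finally show ?thesis .
      qed simp
    qed
  qed
  also have "\<dots> = ?C + ennreal (ln ?K) + (\<integral>\<^sup>+ w. ennreal (?q w) \<partial>lborel)"
    by (simp add: nn_integral_add nn_integral_cmult int_h)
  also have "\<dots> \<le> ?C + ennreal (ln ?K) + 1"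
    by (intro add_left_mono int_q)
  finally show ?crude .
qed

text \<open>
  If the negative part of \<open>f * ln f\<close> has infinite integral, the right-hand side is infinite. Otherwise the two preceding
  lemmas are added, the finite \<open>ln n\<close> is cancelled, and \<open>n\<close> tends to infinity. In the proof \<open>?A\<close> and
  \<open>?B\<close> are the integrals of the negative and positive parts of \<open>f * ln f\<close>, and \<open>?A'\<close>, \<open>?B'\<close> those of \<open>h * ln h\<close>.
\<close>

lemma shannon_entropy_density_sum_le:
  assumes "s_concave 0 f"
  shows "shannon_entropy_density h \<le> shannon_entropy_density f + ereal (ln (2 ^ CARD('n)))"
proof -
  let ?K = "2 ^ CARD('n) :: real"
  let ?A = "\<integral>\<^sup>+ x. ennreal (- (f x * ln (f x))) \<partial>lborel" and ?B = "\<integral>\<^sup>+ x. ennreal (f x * ln (f x)) \<partial>lborel"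
  let ?A' = "\<integral>\<^sup>+ x. ennreal (- (h x * ln (h x))) \<partial>lborel" and ?B' = "\<integral>\<^sup>+ x. ennreal (h x * ln (h x)) \<partial>lborel"
  show ?thesis
  proof (cases "?A = \<infinity>")
    case True
    then show ?thesis by (simp add: shannon_entropy_density_def)
  next
    case A_fin: False
    \<comment> \<open>For \<open>n = 1\<close> the constant \<open>ln n\<close> vanishes, and the cross term is at most \<open>?A\<close>.\<close>
    have A'_fin: "?A' \<noteq> \<infinity>"
    proof -
      let ?C = "\<integral>\<^sup>+ w. ennreal (h w) * ennreal (ln (real 1 / min (f ((1/2) *\<^sub>R w)) (real 1))) \<partial>lborel"
      have "?C \<le> ?A"
        using truncated_cross_entropy_le[OF assms, of 1] by (auto intro: order_trans[rotated])
      moreover have "?A' \<le> ?C + ennreal (ln ?K) + 1"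
        using gibbs_truncated(2)[OF assms, of 1] by simp
      ultimately show ?thesis
        using A_fin by (auto simp: top_unique)
    qed
    let ?S = "?A + ennreal (ln ?K) + ?B'"
    have trunc: "?A' + (\<integral>\<^sup>+ x. ennreal (min (f x) (real n) * ln (min (f x) (real n))) \<partial>lborel) \<le> ?S"
      if n: "n \<ge> 1" for n :: nat
    proof -
      let ?g = "\<lambda>x. min (f x) (real n)"
      let ?Bn = "\<integral>\<^sup>+ x. ennreal (?g x * ln (?g x)) \<partial>lborel"
      let ?C = "\<integral>\<^sup>+ w. ennreal (h w) * ennreal (ln (real n / ?g ((1/2) *\<^sub>R w))) \<partial>lborel"
      have "ennreal (ln (real n)) + (?A' + ?Bn) = (ennreal (ln (real n)) + ?A') + ?Bn"
        by (simp add: add_ac)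
      also have "\<dots> \<le> (?C + ennreal (ln ?K) + ?B') + ?Bn"
        by (intro add_right_mono gibbs_truncated(1)[OF assms n])
      also have "\<dots> = (?C + ?Bn) + (ennreal (ln ?K) + ?B')"
        by (simp only: add_ac)
      also have "\<dots> \<le> (ennreal (ln (real n)) + ?A) + (ennreal (ln ?K) + ?B')"
        by (intro add_right_mono truncated_cross_entropy_le[OF assms n])
      also have "\<dots> = ennreal (ln (real n)) + ?S"
        by (simp only: add_ac)
      finally show ?thesis
        by (subst (asm) ennreal_add_left_cancel_le) simp
    qed
    have "?B \<le> ?S - ?A'"
    proof (rule nn_integral_le_if_truncations_le[where F="\<lambda>t. ennreal (t * ln t)"])
      fix n :: nat assume "n \<ge> 1"
      from ennreal_minus_mono[OF trunc[OF this] order_refl[of ?A']]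
      show "(\<integral>\<^sup>+ x. ennreal (min (f x) (real n) * ln (min (f x) (real n))) \<partial>lborel) \<le> ?S - ?A'"
        using A'_fin by (simp only: ennreal_add_diff_cancel_left infinity_ennreal_def not_False_eq_True)
    qed auto
    then have "?B + ?A' \<le> (?S - ?A') + ?A'"
      by (rule add_right_mono)
    also have "\<dots> = ?S"
      using trunc[of 1] by (intro diff_add_cancel_ennreal order_trans[OF _ trunc[of 1]]) auto
    finally have "?B + ?A' \<le> ?S" .
    then show ?thesis
      unfolding shannon_entropy_density_def
      by (intro enn2ereal_diff_le A_fin A'_fin) simp_all
  qed
qed

end

text \<open>
  Outside the context these rules have premises with variables that do not occur in the conclusion, which
  makes them unsuitable for automatic measurability proofs.
\<close>

declare f_measurable [measurable del] h_measurable [measurable del]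
  X_measurable [measurable del] Y_measurable [measurable del]

theorem corollary27:
  fixes M :: "'a measure"
    and X Y :: "'a \<Rightarrow> real ^ 'n"
    and f :: "real ^ 'n \<Rightarrow> real"
    and s r :: ereal
  assumes "prob_space M"
    and "s > ereal (- 1 / real CARD('n))"
    and "r = 1 + s"
    and "has_density M X f"
    and "has_density M Y f"
    and "s_concave s f"
  shows "renyi_entropy_power M r (\<lambda>\<omega>. X \<omega> + Y \<omega>) \<le> 4 * renyi_entropy_power M r X"
proof (cases "\<exists>h. has_density M (\<lambda>\<omega>. X \<omega> + Y \<omega>) h")
  case False
  then have "renyi_entropy M r (\<lambda>\<omega>. X \<omega> + Y \<omega>) = - \<infinity>"
    by (simp add: renyi_entropy_def)
  then show ?thesis
    by (simp add: renyi_entropy_power_def ext_exp_def)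
next
  case True
  then obtain h where h: "has_density M (\<lambda>\<omega>. X \<omega> + Y \<omega>) h" by blast
  note pair = assms(1,4,5) h
  \<comment> \<open>The lower bound on \<open>s\<close> makes the order \<open>1 + s\<close> positive, so the support size entropy of order \<open>0\<close> never arises.\<close>
  have "- 1 \<le> - 1 / real CARD('n)"
    by (simp add: Suc_le_eq)
  then have s: "s > ereal (- 1)"
    using assms(2) by (metis ereal_less_eq(3) le_less_trans)
  have "renyi_entropy_density r h \<le> renyi_entropy_density r f + ereal (ln (2 ^ CARD('n)))"
  proof (cases s)
    case (real \<sigma>)
    show ?thesis
    proof (cases "\<sigma> = 0")
      case True
      then show ?thesis
        using shannon_entropy_density_sum_le[OF pair] assms(3,6) real
        by (simp add: renyi_entropy_density_def zero_ereal_def[symmetric])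
    next
      case False
      then show ?thesis
        using renyi_entropy_density_sum_le_real[OF pair, of \<sigma>] assms(3,6) real s by simp
    qed
  next
    case PInf
    then show ?thesis
      using renyi_entropy_density_sum_le_infinity[OF pair] assms(3,6) by simp
  next
    case MInf
    then show ?thesis using s by simp
  qed
  then show ?thesis
    unfolding renyi_entropy_power_def renyi_entropy_eq[OF assms(1,4)] renyi_entropy_eq[OF assms(1) h]
    by (intro ext_exp_entropy_power_mono) auto
qed

end
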